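(* Let $X$ be a geodesic metric space whose set of all geodesic segments forms a navigable path system. Then $X$ is Morse dichotomous.
   Context: Let $\mathcal P$ be the set of all geodesic segments of $X$ (including trivial ones). An $(n,\mathcal P)$-polygonal line is a concatenation of at most $n$ geodesic segments; $\alpha^\pm$ denote endpoints and $\|p\|$ length. $\mathcal P$ is navigable if there are $C\ge1$ and an integer $k\ge1$ such that for every $R\ge C$, $m\in X$, $n$, and $(n,\mathcal P)$-polygonal line $\alpha$ with $d(\alpha,m)\ge R$ and $d(\alpha^\pm,m)\le2R$, there is a $(kn,\mathcal P)$-polygonal line $p$ with the same endpoints as $\alpha$, $\|p\|\le CnR$, avoiding the closed ball $B(m,R/C)$. A $(Q,q)$-quasi-geodesic ($Q\ge1,q\ge0$) is a map $\gamma:I\to X$, $I\subseteq\mathbb R$ an interval, with $\frac1Q|t_1-t_2|-q\le d(\gamma(t_1),\gamma(t_2))\le Q|t_1-t_2|+q$. Convention: quasi-geodesics are assumed improved, i.e. continuous and such that the length of $\gamma|_{[t,t']}$ is at most $k_1d(\gamma(t),\gamma(t'))+k_2$, where $q'=2(Q+q)$, $k_1=Q(Q+q)$, $k_2=(Qq'+3)(Q+q)$. A Morse gauge is a function $M:\mathbb R_{\ge1}\times\mathbb R_{\ge0}\to\mathbb R_{\ge0}$, non-decreasing in each variable and continuous in the second. A (quasi-)geodesic $\gamma$ is $M$-Morse if every $(Q,q)$-quasi-geodesic with endpoints $\gamma(s),\gamma(t)$ lies in the $M(Q,q)$-neighbourhood of $\gamma|_{[s,t]}$. A quasi-geodesic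 $\gamma$ is $C$-(strongly) contracting if for each ball $B$ disjoint from $\gamma$, $\mathrm{diam}(\pi_\gamma(B))\le C$, where $\pi_\gamma:X\to2^\gamma$ is the closest point projection. $X$ is Morse dichotomous if for every Morse gauge $M$ there is $C$ such that all $M$-Morse geodesics are $C$-strongly contracting. *)

theory Defs
  imports "HOL-Analysis.Analysis"
begin

definition curve_length :: "(real \<Rightarrow> 'a::metric_space) \<Rightarrow> real \<Rightarrow> real \<Rightarrow> ereal" where
  "curve_length p a b =
     (SUP (n, t) \<in> {(n, t). mono_on {..n} t \<and> t 0 = a \<and> t n = b}.
        ereal (\<Sum>i<(n::nat). dist (p (t i)) (p (t (Suc i)))))"

text \<open>A path is a pair \<open>(p, T)\<close> of a map and a duration; only the values of \<open>p\<close> on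
  \<open>{0..T}\<close> matter.\<close>

definition geodesic_segments :: "((real \<Rightarrow> 'a::metric_space) \<times> real) set" where
  "geodesic_segments =
     {(g, l). 0 \<le> l \<and> (\<forall>s\<in>{0..l}. \<forall>t\<in>{0..l}. dist (g s) (g t) = \<bar>s - t\<bar>)}"

definition geodesic_metric_space :: "'a::metric_space itself \<Rightarrow> bool" where
  "geodesic_metric_space _ \<longleftrightarrow>
     (\<forall>x y :: 'a. \<exists>(g, l) \<in> geodesic_segments. g 0 = x \<and> g l = y)"

text \<open>The path \<open>(p, T)\<close> is the concatenation of \<open>k\<close> members of \<open>\<P>\<close>, with \<open>1 \<le> k \<le> n\<close>; the
  breakpoints are \<open>t 0, \<dots>, t k\<close>.\<close>

definition polygonal_line ::
    "((real \<Rightarrow> 'a::metric_space) \<times> real) set \<Rightarrow> nat \<Rightarrow> (real \<Rightarrow> 'a) \<Rightarrow> real \<Rightarrow> bool" where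
  "polygonal_line \<P> n p T \<longleftrightarrow>
     (\<exists>k t. 1 \<le> k \<and> k \<le> n \<and> t 0 = 0 \<and> t k = T \<and>
        (\<forall>i<k. t i \<le> t (Suc i) \<and> ((\<lambda>s. p (t i + s)), t (Suc i) - t i) \<in> \<P>))"

definition navigable :: "((real \<Rightarrow> 'a::metric_space) \<times> real) set \<Rightarrow> bool" where
  "navigable \<P> \<longleftrightarrow>
     (\<exists>(C::real) (k::nat). 1 \<le> C \<and> 1 \<le> k \<and>
        (\<forall>R m n \<alpha> T.
           C \<le> R \<and> polygonal_line \<P> n \<alpha> T \<and> R \<le> infdist m (\<alpha> ` {0..T}) \<and>
           dist (\<alpha> 0) m \<le> 2 * R \<and> dist (\<alpha> T) m \<le> 2 * R \<longrightarrow>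
           (\<exists>p T'. polygonal_line \<P> (k * n) p T' \<and> p 0 = \<alpha> 0 \<and> p T' = \<alpha> T \<and>
              curve_length p 0 T' \<le> ereal (C * real n * R) \<and>
              p ` {0..T'} \<inter> cball m (R / C) = {})))"

text \<open>Quasi-geodesics are improved by convention: continuous, with the length of every subpath
  linearly controlled by the distance between its endpoints.\<close>

definition quasi_geodesic :: "real \<Rightarrow> real \<Rightarrow> real set \<Rightarrow> (real \<Rightarrow> 'a::metric_space) \<Rightarrow> bool" where
  "quasi_geodesic Q q I \<gamma> \<longleftrightarrow>
     1 \<le> Q \<and> 0 \<le> q \<and> is_interval I \<and>
     (\<forall>s\<in>I. \<forall>t\<in>I. \<bar>s - t\<bar> / Q - q \<le> dist (\<gamma> s) (\<gamma> t) \<and>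
                  dist (\<gamma> s) (\<gamma> t) \<le> Q * \<bar>s - t\<bar> + q) \<and>
     continuous_on I \<gamma> \<and>
     (let q' = 2 * (Q + q); k1 = Q * (Q + q); k2 = (Q * q' + 3) * (Q + q)
      in \<forall>s\<in>I. \<forall>t\<in>I. s \<le> t \<longrightarrow> curve_length \<gamma> s t \<le> ereal (k1 * dist (\<gamma> s) (\<gamma> t) + k2))"

definition geodesic :: "real set \<Rightarrow> (real \<Rightarrow> 'a::metric_space) \<Rightarrow> bool" where
  "geodesic I \<gamma> \<longleftrightarrow> is_interval I \<and> (\<forall>s\<in>I. \<forall>t\<in>I. dist (\<gamma> s) (\<gamma> t) = \<bar>s - t\<bar>)"

definition morse_gauge :: "(real \<Rightarrow> real \<Rightarrow> real) \<Rightarrow> bool" where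
  "morse_gauge M \<longleftrightarrow>
     (\<forall>Q\<ge>1. \<forall>q\<ge>0. 0 \<le> M Q q) \<and>
     (\<forall>q\<ge>0. mono_on {1..} (\<lambda>Q. M Q q)) \<and>
     (\<forall>Q\<ge>1. mono_on {0..} (M Q)) \<and>
     (\<forall>Q\<ge>1. continuous_on {0..} (M Q))"

definition morse :: "(real \<Rightarrow> real \<Rightarrow> real) \<Rightarrow> real set \<Rightarrow> (real \<Rightarrow> 'a::metric_space) \<Rightarrow> bool" where
  "morse M I \<gamma> \<longleftrightarrow>
     (\<forall>Q q s t a b \<eta>.
        s \<in> I \<and> t \<in> I \<and> s \<le> t \<and> a \<le> b \<and> quasi_geodesic Q q {a..b} \<eta> \<and>
        \<eta> a = \<gamma> s \<and> \<eta> b = \<gamma> t \<longrightarrow>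
        (\<forall>u\<in>{a..b}. infdist (\<eta> u) (\<gamma> ` {s..t}) \<le> M Q q))"

definition closest_points :: "'a::metric_space set \<Rightarrow> 'a \<Rightarrow> 'a set" where
  "closest_points S x = {p \<in> S. \<forall>y\<in>S. dist x p \<le> dist x y}"

text \<open>Boundedness is required separately because \<^const>\<open>diameter\<close> is only meaningful on bounded
  sets.\<close>

definition strongly_contracting ::
    "real \<Rightarrow> real set \<Rightarrow> (real \<Rightarrow> 'a::metric_space) \<Rightarrow> bool" where
  "strongly_contracting C I \<gamma> \<longleftrightarrow>
     (\<forall>x r. \<forall>B \<in> {ball x r, cball x r}. B \<inter> \<gamma> ` I = {} \<longrightarrow>
        (let P = (\<Union>z\<in>B. closest_points (\<gamma> ` I) z) in bounded P \<and> diameter P \<le> C))"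

definition morse_dichotomous :: "'a::metric_space itself \<Rightarrow> bool" where
  "morse_dichotomous _ \<longleftrightarrow>
     (\<forall>M. morse_gauge M \<longrightarrow>
        (\<exists>C. \<forall>I (\<gamma> :: real \<Rightarrow> 'a). geodesic I \<gamma> \<and> morse M I \<gamma> \<longrightarrow> strongly_contracting C I \<gamma>))"

end

theory Submission
  imports Defs
begin

text \<open>If a geodesic is not contracting, then two geodesics from a ball to far apart projection points
  \<open>p1\<close>, \<open>p2\<close>, joined through the centre of the ball, give a hexagonal line around the midpoint \<open>m\<close> of
  \<open>p1\<close> and \<open>p2\<close>. Navigability turns it into a path of length \<open>O(R)\<close> that avoids a ball of radius
  \<open>\<rho> = R / C\<close> about \<open>m\<close>. Now give the ball a large weight \<open>K\<close>, depending only on \<open>C\<close>. A \<open>1\<close>-Lipschitz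
  path whose weighted length is within \<open>1\<close> of the infimum is a quasi-geodesic with constants
  \<open>(1 + K, 1)\<close>, since replacing a subpath by a geodesic cannot save more than \<open>1\<close>; and it cannot come
  close to \<open>m\<close>, since crossing the heavy ball would cost more than the path just found. A Morse
  geodesic, however, forces each such quasi-geodesic to pass close to \<open>m\<close>.\<close>

section \<open>Paths of nearly minimal weighted length\<close>

text \<open>A Lipschitz bound instead of unit speed makes restriction and concatenation stay in the
  class without reparametrising. The cost integrates \<open>w\<close> over time, so for
  \<open>w\<close> at least 1 it bounds the duration.\<close>

definition weighted_path ::
    "('a::metric_space \<Rightarrow> real) \<Rightarrow> (real \<Rightarrow> 'a) \<Rightarrow> real \<Rightarrow> 'a \<Rightarrow> 'a \<Rightarrow> real \<Rightarrow> bool" where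
  "weighted_path w \<eta> T x y c \<longleftrightarrow>
     0 \<le> T \<and> 1-lipschitz_on {0..T} \<eta> \<and> \<eta> 0 = x \<and> \<eta> T = y \<and>
     ((\<lambda>s. w (\<eta> s)) has_integral c) {0..T}"

lemma lipschitz_on_shift:
  fixes f :: "real \<Rightarrow> 'a::metric_space"
  assumes "L-lipschitz_on {a+s..b+s} f"
  shows "L-lipschitz_on {a..b} (\<lambda>u. f (s + u))"
proof (rule lipschitz_onI)
  fix x y assume "x \<in> {a..b}" "y \<in> {a..b}"
  then show "dist (f (s + x)) (f (s + y)) \<le> L * dist x y"
    using lipschitz_onD[OF assms, of "s + x" "s + y"] by auto
qed (rule lipschitz_on_nonneg[OF assms])

lemma weighted_path_concat:
  assumes p: "weighted_path w \<eta> T x y c" and q: "weighted_path w \<theta> S y z d"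
  shows "weighted_path w (\<lambda>s. if s \<le> T then \<eta> s else \<theta> (- T + s)) (T + S) x z (c + d)"
    (is "weighted_path w ?f _ _ _ _")
proof -
  have TS: "0 \<le> T" "0 \<le> S" using p q by (auto simp: weighted_path_def)
  have "1-lipschitz_on {T..T+S} (\<lambda>s. \<theta> (- T + s))"
    by (rule lipschitz_on_shift) (use q in \<open>auto simp: weighted_path_def\<close>)
  then have lip: "1-lipschitz_on {0..T+S} ?f"
    using p q by (intro lipschitz_on_concat) (auto simp: weighted_path_def)
  have "((\<lambda>s. w (?f s)) has_integral c) {0..T}"
    using p by (auto simp: weighted_path_def intro: has_integral_eq[rotated])
  moreover have "((\<lambda>s. w (?f s)) has_integral d) {T..T+S}"
  proof -
    have "((\<lambda>s. w (\<theta> s)) \<circ> (+) (-T) has_integral d) {T..T+S}"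
      using q unfolding has_integral_shift_Icc_real by (simp add: weighted_path_def)
    moreover have "((\<lambda>s. w (\<theta> s)) \<circ> (+) (-T)) s = w (?f s)" if "s \<in> {T..T+S}" for s
      using that p q by (auto simp: weighted_path_def)
    ultimately show ?thesis by (rule has_integral_eq[rotated])
  qed
  ultimately have "((\<lambda>s. w (?f s)) has_integral (c + d)) {0..T+S}"
    using TS by (intro has_integral_combine[of 0 T "T+S"]) auto
  then show ?thesis
    using TS lip p q by (auto simp: weighted_path_def)
qed

lemma weighted_integrable:
  fixes \<eta> :: "real \<Rightarrow> 'a::metric_space"
  assumes "1-lipschitz_on {a..b} \<eta>" and "continuous_on UNIV w"
  shows "(\<lambda>s. w (\<eta> s) :: real) integrable_on {a..b}"
  using assms
  by (intro integrable_continuous_real continuous_on_compose2[OF assms(2)])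
     (auto intro: lipschitz_on_continuous_on)

lemma weighted_path_sub:
  assumes p: "weighted_path w \<eta> T x y c" and w: "continuous_on UNIV w"
    and "0 \<le> s" "s \<le> t" "t \<le> T"
  shows "weighted_path w (\<lambda>u. \<eta> (s + u)) (t - s) (\<eta> s) (\<eta> t) (integral {s..t} (\<lambda>u. w (\<eta> u)))"
proof -
  have lip: "1-lipschitz_on {s..t} \<eta>"
    using p assms(3-) by (auto simp: weighted_path_def intro: lipschitz_on_subset)
  then have "((\<lambda>u. w (\<eta> u)) \<circ> (+) s has_integral integral {s..t} (\<lambda>u. w (\<eta> u))) {0..t-s}"
    unfolding has_integral_shift_Icc_real
    using weighted_integrable[OF lip w] by (simp add: integrable_integral)
  then show ?thesis
    using assms(3-) lip by (auto simp: weighted_path_def o_def intro!: lipschitz_on_shift)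
qed

lemma weighted_path_geodesic:
  fixes x y :: "'a::metric_space"
  assumes "geodesic_metric_space TYPE('a)" and w: "continuous_on UNIV w" and Q: "\<And>z. w z \<le> Q"
  obtains \<eta> T c where "weighted_path w \<eta> T x y c" "c \<le> Q * dist x y"
proof -
  obtain g l where g: "0 \<le> l" "g 0 = x" "g l = y"
      "\<And>s t. s \<in> {0..l} \<Longrightarrow> t \<in> {0..l} \<Longrightarrow> dist (g s) (g t) = \<bar>s - t\<bar>"
    using assms(1) unfolding geodesic_metric_space_def geodesic_segments_def by fastforce
  have lip: "1-lipschitz_on {0..l} g"
    by (rule lipschitz_onI) (auto simp: g dist_real_def)
  let ?c = "integral {0..l} (\<lambda>s. w (g s))"
  have "?c \<le> integral {0..l} (\<lambda>s. Q)"
    by (intro integral_le weighted_integrable[OF lip w]) (auto simp: Q)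
  moreover have "dist x y = l" using g(4)[of 0 l] g(1-3) by simp
  ultimately have "?c \<le> Q * dist x y" using g(1) by (simp add: mult.commute)
  moreover have "weighted_path w g l x y ?c"
    using g lip weighted_integrable[OF lip w] by (simp add: weighted_path_def integrable_integral)
  ultimately show thesis using that by blast
qed

section \<open>Lipschitz paths as quasi-geodesics\<close>

lemma curve_length_lipschitz_le:
  assumes "1-lipschitz_on {a..b} \<eta>"
  shows "curve_length \<eta> a b \<le> ereal (b - a)"
  unfolding curve_length_def
proof (rule SUP_least, clarify)
  fix n :: nat and t :: "nat \<Rightarrow> real"
  assume t: "mono_on {..n} t" and ab: "a = t 0" "b = t n"
  have "(\<Sum>i<n. dist (\<eta> (t i)) (\<eta> (t (Suc i)))) \<le> (\<Sum>i<n. t (Suc i) - t i)"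
  proof (rule sum_mono)
    fix i assume "i \<in> {..<n}"
    then have "t 0 \<le> t i" "t i \<le> t (Suc i)" "t (Suc i) \<le> t n"
      using t by (auto intro: mono_onD)
    then show "dist (\<eta> (t i)) (\<eta> (t (Suc i))) \<le> t (Suc i) - t i"
      using lipschitz_onD[OF assms, of "t i" "t (Suc i)"] ab by (auto simp: dist_real_def)
  qed
  also have "\<dots> = t n - t 0" by (rule sum_lessThan_telescope)
  finally show "ereal (\<Sum>i<n. dist (\<eta> (t i)) (\<eta> (t (Suc i)))) \<le> ereal (t n - t 0)" by simp
qed

text \<open>For a 1-Lipschitz path, elapsed time bounds both distance and length from above. Hence
  \<open>low\<close> alone also yields the length condition, as \<open>Q\<close> and
  \<open>q\<close> do not exceed \<open>k1\<close> and \<open>k2\<close>.\<close>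

lemma quasi_geodesic_lipschitzI:
  assumes lip: "1-lipschitz_on {0..T} \<eta>" and Q: "1 \<le> Q" and q: "0 \<le> q"
    and low: "\<And>s t. 0 \<le> s \<Longrightarrow> s \<le> t \<Longrightarrow> t \<le> T \<Longrightarrow> t - s \<le> Q * dist (\<eta> s) (\<eta> t) + q"
  shows "quasi_geodesic Q q {0..T} \<eta>"
proof -
  have up: "dist (\<eta> s) (\<eta> t) \<le> \<bar>s - t\<bar>" if "s \<in> {0..T}" "t \<in> {0..T}" for s t
    using lipschitz_onD[OF lip that] by (simp add: dist_real_def)
  have "\<bar>s - t\<bar> / Q - q \<le> dist (\<eta> s) (\<eta> t) \<and> dist (\<eta> s) (\<eta> t) \<le> Q * \<bar>s - t\<bar> + q"
    if "s \<in> {0..T}" "t \<in> {0..T}" for s t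
  proof
    have "\<bar>s - t\<bar> \<le> Q * dist (\<eta> s) (\<eta> t) + q"
      using low[of s t] low[of t s] that by (cases "s \<le> t") (auto simp: dist_commute)
    \<comment> \<open>Enlarging \<open>q\<close> to \<open>Q * q\<close> makes the division by
      \<open>Q\<close> leave exactly \<open>q\<close>.\<close>
    also have "\<dots> \<le> Q * dist (\<eta> s) (\<eta> t) + Q * q"
      using mult_right_mono[OF Q q] by simp
    finally show "\<bar>s - t\<bar> / Q - q \<le> dist (\<eta> s) (\<eta> t)"
      using Q by (simp add: field_simps)
    show "dist (\<eta> s) (\<eta> t) \<le> Q * \<bar>s - t\<bar> + q"
      using up[OF that] mult_right_mono[OF Q, of "\<bar>s - t\<bar>"] q by simp
  qed
  moreover have "curve_length \<eta> s t
      \<le> ereal (Q * (Q + q) * dist (\<eta> s) (\<eta> t) + (Q * (2 * (Q + q)) + 3) * (Q + q))"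
    if "s \<in> {0..T}" "t \<in> {0..T}" "s \<le> t" for s t
  proof -
    have "curve_length \<eta> s t \<le> ereal (t - s)"
      using that lip by (intro curve_length_lipschitz_le) (auto intro: lipschitz_on_subset)
    moreover have "t - s \<le> Q * dist (\<eta> s) (\<eta> t) + q" using low that by simp
    moreover have "Q * dist (\<eta> s) (\<eta> t) \<le> Q * (Q + q) * dist (\<eta> s) (\<eta> t)"
      using Q q mult_left_mono[of 1 "Q + q" Q] by (intro mult_right_mono) auto
    moreover have "q \<le> (Q * (2 * (Q + q)) + 3) * (Q + q)"
    proof -
      have "1 * (Q + q) \<le> (Q * (2 * (Q + q)) + 3) * (Q + q)"
        using Q q by (intro mult_right_mono) (auto intro: add_increasing)
      then show ?thesis using Q by argo
    qed
    ultimately show ?thesis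
      by (meson add_mono ereal_less_eq(3) order_trans)
  qed
  ultimately show ?thesis
    using Q q lip unfolding quasi_geodesic_def Let_def
    by (auto intro: lipschitz_on_continuous_on is_interval_cc)
qed

text \<open>A minimiser need not exist, so a path within 1 of the infimum is taken. Putting a
  geodesic in place of a piece gives a competitor, so the piece costs less than the geodesic plus 1.
  As \<open>w\<close> is at least 1, that cost bounds the time spent on the piece.\<close>

lemma near_minimal_weighted_path_quasi_geodesic:
  fixes x y :: "'a::metric_space"
  assumes geo: "geodesic_metric_space TYPE('a)"
    and w: "continuous_on UNIV w" and w1: "\<And>z. 1 \<le> w z" and wQ: "\<And>z. w z \<le> Q"
    and p: "weighted_path w p T0 x y c0"
  obtains \<eta> T c where "weighted_path w \<eta> T x y c" "c < c0 + 1" "quasi_geodesic Q 1 {0..T} \<eta>"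
proof -
  define A where "A = {c. \<exists>\<eta> T. weighted_path w \<eta> T x y c}"
  have "0 \<le> c" if c: "c \<in> A" for c
  proof -
    obtain \<eta> :: "real \<Rightarrow> 'a" and T where "((\<lambda>s. w (\<eta> s)) has_integral c) {0..T}"
      using c unfolding A_def weighted_path_def by blast
    then show ?thesis
      by (rule has_integral_nonneg) (use w1 in \<open>auto intro: order_trans[OF zero_le_one]\<close>)
  qed
  then have bdd: "bdd_below A" by (rule bdd_belowI)
  have c0: "c0 \<in> A" using p by (auto simp: A_def)
  then obtain c where c: "c \<in> A" "c < Inf A + 1"
    using cInf_lessD[of A "Inf A + 1"] by auto
  then obtain \<eta> T where \<eta>: "weighted_path w \<eta> T x y c" by (auto simp: A_def)
  have lip: "1-lipschitz_on {0..T} \<eta>" and T: "0 \<le> T" using \<eta> by (auto simp: weighted_path_def)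
  have low: "t - s \<le> Q * dist (\<eta> s) (\<eta> t) + 1" if st: "0 \<le> s" "s \<le> t" "t \<le> T" for s t
  proof -
    let ?I = "\<lambda>a b. integral {a..b} (\<lambda>u. w (\<eta> u))"
    obtain g l d where g: "weighted_path w g l (\<eta> s) (\<eta> t) d" "d \<le> Q * dist (\<eta> s) (\<eta> t)"
      using weighted_path_geodesic[OF geo w wQ] .
    have "weighted_path w (\<lambda>u. \<eta> (0 + u)) (s - 0) (\<eta> 0) (\<eta> s) (?I 0 s)"
      "weighted_path w (\<lambda>u. \<eta> (t + u)) (T - t) (\<eta> t) (\<eta> T) (?I t T)"
      using st by (intro weighted_path_sub[OF \<eta> w]; simp)+
    \<comment> \<open>The competitor: \<open>\<eta>\<close> up to time \<open>s\<close>, the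
      geodesic \<open>g\<close>, then \<open>\<eta>\<close> from time \<open>t\<close> on.\<close>
    from weighted_path_concat[OF weighted_path_concat[OF this(1) g(1)] this(2)]
    have "?I 0 s + d + ?I t T \<in> A"
      using \<eta> unfolding A_def weighted_path_def by blast
    then have "c < ?I 0 s + d + ?I t T + 1"
      using c(2) cInf_lower[OF _ bdd] by fastforce
    moreover have "c = ?I 0 s + ?I s t + ?I t T"
    proof -
      have int: "(\<lambda>u. w (\<eta> u)) integrable_on {0..b}" if "b \<le> T" for b
        using that by (intro weighted_integrable[OF _ w] lipschitz_on_subset[OF lip]) auto
      have "c = ?I 0 T" using \<eta> by (auto simp: weighted_path_def dest: integral_unique)
      also have "\<dots> = ?I 0 t + ?I t T"
        using Henstock_Kurzweil_Integration.integral_combine[OF _ _ int[of T], of t] st by simp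
      also have "?I 0 t = ?I 0 s + ?I s t"
        using Henstock_Kurzweil_Integration.integral_combine[OF _ _ int[of t], of s] st by simp
      finally show ?thesis .
    qed
    moreover have "t - s \<le> ?I s t"
    proof -
      have "integral {s..t} (\<lambda>u. 1) \<le> ?I s t"
        using st by (intro integral_le weighted_integrable[OF _ w] lipschitz_on_subset[OF lip])
          (auto simp: w1)
      then show ?thesis using st by simp
    qed
    ultimately show ?thesis using g(2) by linarith
  qed
  have "1 \<le> Q" using w1 wQ order_trans by blast
  then have "quasi_geodesic Q 1 {0..T} \<eta>"
    by (intro quasi_geodesic_lipschitzI lip low) auto
  moreover have "c < c0 + 1" using c(2) cInf_lower[OF c0 bdd] by simp
  ultimately show thesis using that \<eta> by blast
qed

text \<open>The given path misses the heavy ball, so it costs only \<open>T\<close>. A path reaching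
  within \<open>\<rho> / 2\<close> of \<open>m\<close> spends at least \<open>\<rho> / 2\<close> of
  its time within \<open>3 / 4 * \<rho>\<close> of \<open>m\<close>, which is too expensive for a
  nearly minimal one.\<close>

lemma quasi_geodesic_avoiding_ball:
  fixes p :: "real \<Rightarrow> 'a::metric_space"
  assumes geo: "geodesic_metric_space TYPE('a)"
    and lip: "1-lipschitz_on {0..T} p" and T: "0 \<le> T" "T \<le> L * \<rho>" and \<rho>: "1 \<le> \<rho>" and L: "0 \<le> L"
    and avoid: "\<And>s. s \<in> {0..T} \<Longrightarrow> \<rho> < dist (p s) m"
  obtains \<eta> S where "0 \<le> S" "\<eta> 0 = p 0" "\<eta> S = p T"
    "quasi_geodesic (1 + 8 * (L + 1)) 1 {0..S} \<eta>" "\<forall>s\<in>{0..S}. \<rho> / 2 < dist (\<eta> s) m"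
proof -
  \<comment> \<open>Chosen so that \<open>K / 4\<close> over a time \<open>\<rho> / 2\<close>
    already costs \<open>(L + 1) * \<rho>\<close>.\<close>
  define K where "K = 8 * (L + 1)"
  \<comment> \<open>A tent of height \<open>1 + K\<close> at \<open>m\<close>, falling to 1 at
    distance \<open>\<rho>\<close>. Unlike an indicator function it is continuous, hence integrable
    along Lipschitz paths.\<close>
  define w where "w z = 1 + K * max 0 (1 - dist z m / \<rho>)" for z
  have K: "0 \<le> K" using L by (simp add: K_def)
  have w: "continuous_on UNIV w" unfolding w_def by (intro continuous_intros) (use \<rho> in auto)
  have w1: "1 \<le> w z" for z using K by (simp add: w_def)
  have wQ: "w z \<le> 1 + K" for z
    using K \<rho> mult_left_mono[of "max 0 (1 - dist z m / \<rho>)" 1 K] by (simp add: w_def)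
  have "w (p s) = 1" if "s \<in> {0..T}" for s
  proof -
    have "1 - dist (p s) m / \<rho> \<le> 0" using avoid[OF that] \<rho> by (simp add: field_simps)
    then show ?thesis by (simp add: w_def max_def)
  qed
  then have "((\<lambda>s. w (p s)) has_integral T) {0..T}"
    using has_integral_const_real[of "1::real" 0 T] T
    by (auto intro: has_integral_eq[of "{0..T}" "\<lambda>_. 1"])
  then have "weighted_path w p T (p 0) (p T) T"
    using T lip by (simp add: weighted_path_def)
  from near_minimal_weighted_path_quasi_geodesic[OF geo w w1 wQ this]
  obtain \<eta> S c where \<eta>: "weighted_path w \<eta> S (p 0) (p T) c" "c < T + 1"
      "quasi_geodesic (1 + K) 1 {0..S} \<eta>" .
  have lip\<eta>: "1-lipschitz_on {0..S} \<eta>" and S: "0 \<le> S" "\<eta> 0 = p 0" "\<eta> S = p T"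
    using \<eta> by (auto simp: weighted_path_def)
  have "\<rho> / 2 < dist (\<eta> u) m" if u: "u \<in> {0..S}" for u
  proof (rule ccontr)
    assume "\<not> \<rho> / 2 < dist (\<eta> u) m"
    then have close: "dist (\<eta> u) m \<le> \<rho> / 2" by simp
    have lipd: "dist (\<eta> s) m \<le> dist (\<eta> u) m + \<bar>s - u\<bar>" if "s \<in> {0..S}" for s
      using lipschitz_onD[OF lip\<eta> that u] dist_triangle[of "\<eta> s" m "\<eta> u"]
      by (simp add: dist_real_def)
    have end0: "\<rho> < dist (\<eta> 0) m" "\<rho> < dist (\<eta> S) m"
      using avoid[of 0] avoid[of T] T S by auto
    \<comment> \<open>Both ends are farther than \<open>\<rho>\<close> from \<open>m\<close>, so
      more than \<open>\<rho> / 2\<close> of time separates \<open>u\<close> from either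
      end.\<close>
    have u4: "0 \<le> u - \<rho> / 4" "u + \<rho> / 4 \<le> S"
      using lipd[of 0] lipd[of S] end0 close u S \<rho> by auto
    have heavy: "1 + K / 4 \<le> w (\<eta> s)" if "s \<in> {u - \<rho> / 4..u + \<rho> / 4}" for s
    proof -
      have "dist (\<eta> s) m \<le> 3 / 4 * \<rho>" using lipd[of s] that u4 close by auto
      then have "1 / 4 \<le> 1 - dist (\<eta> s) m / \<rho>" using \<rho> by (simp add: field_simps)
      then have "1 / 4 \<le> max 0 (1 - dist (\<eta> s) m / \<rho>)" by (rule max.coboundedI2)
      from mult_left_mono[OF this K] show ?thesis unfolding w_def by linarith
    qed
    have "(L + 1) * \<rho> < (1 + K / 4) * (\<rho> / 2)"
      using \<rho> by (simp add: K_def field_simps)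
    also have "\<dots> = integral {u - \<rho> / 4..u + \<rho> / 4} (\<lambda>_. 1 + K / 4)"
      using \<rho> by (simp add: field_simps)
    also have "\<dots> \<le> integral {u - \<rho> / 4..u + \<rho> / 4} (\<lambda>s. w (\<eta> s))"
      using heavy u4 by (intro integral_le weighted_integrable[OF _ w] lipschitz_on_subset[OF lip\<eta>]) auto
    also have "\<dots> \<le> integral {0..S} (\<lambda>s. w (\<eta> s))"
      using u4 w1 by (intro integral_subset_le weighted_integrable[OF _ w] lipschitz_on_subset[OF lip\<eta>])
        (auto intro: order_trans[OF zero_le_one])
    also have "\<dots> = c" using \<eta>(1) by (auto simp: weighted_path_def dest: integral_unique)
    also have "\<dots> < L * \<rho> + 1" using \<eta>(2) T by simp
    \<comment> \<open>The slack 1 of near minimality is absorbed by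
      \<open>1 \<le> \<rho>\<close>.\<close>
    also have "\<dots> \<le> (L + 1) * \<rho>" using \<rho> by (simp add: algebra_simps)
    finally show False by simp
  qed
  then show thesis using that \<eta>(3) S unfolding K_def by blast
qed

section \<open>Quasi-geodesics with endpoints on a Morse geodesic\<close>

lemma infdist_lessE:
  assumes "infdist x A < d" "A \<noteq> {}"
  obtains a where "a \<in> A" "dist x a < d"
  using assms cInf_lessD[of "dist x ` A" d] by (auto simp: infdist_def)

text \<open>The Morse property puts \<open>\<eta>\<close> near \<open>\<gamma>\<close>; the converse
  comes from continuity. At some time \<open>\<eta>\<close> is equally far from the two halves of
  \<open>\<gamma>\<close> cut at \<open>u\<close>, hence near a point on each side, and
  \<open>\<gamma> u\<close> lies between these points. The margin \<open>e\<close> spares an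
  argument that the infima are attained.\<close>

lemma morse_quasi_geodesic_near:
  assumes g: "geodesic I \<gamma>" and m: "morse M I \<gamma>" and st: "s \<in> I" "t \<in> I" "s \<le> u" "u \<le> t"
    and S: "0 \<le> S" and \<eta>: "quasi_geodesic Q q {0..S} \<eta>" "\<eta> 0 = \<gamma> s" "\<eta> S = \<gamma> t" and e: "0 < e"
  obtains v where "v \<in> {0..S}" "dist (\<eta> v) (\<gamma> u) \<le> 3 * (M Q q + e)"
proof -
  let ?l = "\<lambda>v. infdist (\<eta> v) (\<gamma> ` {s..u})" and ?r = "\<lambda>v. infdist (\<eta> v) (\<gamma> ` {u..t})"
  have I: "{s..t} \<subseteq> I"
    using g st unfolding geodesic_def is_interval_1 by fastforce
  have gd: "dist (\<gamma> a) (\<gamma> b) = \<bar>a - b\<bar>" if "a \<in> {s..t}" "b \<in> {s..t}" for a b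
    using g subsetD[OF I that(1)] subsetD[OF I that(2)] by (simp add: geodesic_def)
  have cont: "continuous_on {0..S} \<eta>" using \<eta>(1) by (simp add: quasi_geodesic_def)
  \<comment> \<open>The ends of \<open>\<eta>\<close> lie on the left and right half respectively,
    so \<open>?l 0\<close> and \<open>?r S\<close> vanish.\<close>
  have "?l 0 - ?r 0 \<le> 0" "0 \<le> ?l S - ?r S"
    using st \<eta> by (auto simp: infdist_nonneg)
  then obtain v where v: "0 \<le> v" "v \<le> S" "?l v - ?r v = 0"
    using IVT'[OF _ _ S continuous_on_diff[OF continuous_on_infdist[OF cont] continuous_on_infdist[OF cont]]]
    by blast
  have "infdist (\<eta> v) (\<gamma> ` {s..t}) \<le> M Q q"
    using m[unfolded morse_def, rule_format, of s t 0 S Q q \<eta> v] st S \<eta> v by auto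
  then have "infdist (\<eta> v) (\<gamma> ` {s..t}) < M Q q + e" using e by simp
  then obtain a where a: "a \<in> {s..t}" "dist (\<eta> v) (\<gamma> a) < M Q q + e"
    using st by (elim infdist_lessE) auto
  have "?l v \<le> dist (\<eta> v) (\<gamma> a)" if "a \<le> u" using a that by (intro infdist_le) auto
  moreover have "?r v \<le> dist (\<eta> v) (\<gamma> a)" if "u \<le> a" using a that by (intro infdist_le) auto
  ultimately have "?l v < M Q q + e" "?r v < M Q q + e"
    using a v(3) by (cases "a \<le> u"; force)+
  then obtain x y where xy: "x \<in> {s..u}" "y \<in> {u..t}"
      "dist (\<eta> v) (\<gamma> x) < M Q q + e" "dist (\<eta> v) (\<gamma> y) < M Q q + e"
    using st by (auto elim!: infdist_lessE)
  have "dist (\<gamma> x) (\<gamma> u) \<le> dist (\<gamma> x) (\<gamma> y)" using xy gd st by auto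
  also have "\<dots> \<le> 2 * (M Q q + e)"
    using xy(3,4) dist_triangle3[of "\<gamma> x" "\<gamma> y" "\<eta> v"] by simp
  finally have "dist (\<eta> v) (\<gamma> u) \<le> 3 * (M Q q + e)"
    using xy(3) dist_triangle[of "\<eta> v" "\<gamma> u" "\<gamma> x"] by simp
  then show thesis using that v by simp
qed

section \<open>Polygonal lines\<close>

text \<open>Segments have unit speed, so the partition at the breakpoints has length sum exactly
  \<open>T\<close>. The third claim turns the length bound of navigability into a bound on
  duration.\<close>

lemma polygonal_line_lipschitz:
  assumes "polygonal_line geodesic_segments n p T"
  shows "0 \<le> T" "1-lipschitz_on {0..T} p" "ereal T \<le> curve_length p 0 T"
proof -
  obtain k t where t: "t 0 = 0" "t k = T" "\<And>i. i < k \<Longrightarrow> t i \<le> t (Suc i)"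
    and seg: "\<And>i. i < k \<Longrightarrow> ((\<lambda>s. p (t i + s)), t (Suc i) - t i) \<in> geodesic_segments"
    using assms unfolding polygonal_line_def by blast
  have piece: "dist (p a) (p b) = \<bar>a - b\<bar>"
    if "i < k" "a \<in> {t i..t (Suc i)}" "b \<in> {t i..t (Suc i)}" for i a b
  proof -
    have "\<forall>a\<in>{0..t (Suc i) - t i}. \<forall>b\<in>{0..t (Suc i) - t i}.
        dist (p (t i + a)) (p (t i + b)) = \<bar>a - b\<bar>"
      using seg[OF that(1)] by (simp add: geodesic_segments_def)
    from this[rule_format, of "a - t i" "b - t i"] show ?thesis using that by auto
  qed
  have "0 \<le> t j \<and> 1-lipschitz_on {0..t j} p" if "j \<le> k" for j
    using that
  proof (induction j)
    case 0
    then show ?case by (simp add: t lipschitz_on_def)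
  next
    case (Suc j)
    have "1-lipschitz_on {t j..t (Suc j)} p"
      by (rule lipschitz_onI) (use piece[of j] Suc.prems in \<open>auto simp: dist_real_def\<close>)
    \<comment> \<open>The case distinction with equal branches only serves to match
      \<open>lipschitz_on_concat\<close>.\<close>
    then have "1-lipschitz_on {0..t (Suc j)} (\<lambda>x. if x \<le> t j then p x else p x)"
      using Suc by (intro lipschitz_on_concat) auto
    then show ?case using Suc t(3)[of j] by simp
  qed
  from this[of k] show "0 \<le> T" "1-lipschitz_on {0..T} p" by (auto simp: t)
  have "mono_on {..k} t"
  proof (rule mono_onI)
    fix i j assume "i \<in> {..k}" "j \<in> {..k}" "i \<le> j"
    from this(3,1,2) show "t i \<le> t j"
      by (induction j rule: dec_induct) (auto intro: order_trans[OF _ t(3)])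
  qed
  then have "ereal (\<Sum>i<k. dist (p (t i)) (p (t (Suc i)))) \<le> curve_length p 0 T"
    unfolding curve_length_def using t by (intro SUP_upper2[of "(k, t)"]) auto
  moreover have "(\<Sum>i<k. dist (p (t i)) (p (t (Suc i)))) = (\<Sum>i<k. t (Suc i) - t i)"
    using piece t(3) by (intro sum.cong) auto
  ultimately show "ereal T \<le> curve_length p 0 T"
    using t by (simp add: sum_lessThan_telescope)
qed

text \<open>Hiding the path and its duration reduces concatenation to a transitivity rule on
  endpoints.\<close>

definition polygonal_in :: "'a::metric_space set \<Rightarrow> nat \<Rightarrow> 'a \<Rightarrow> 'a \<Rightarrow> bool" where
  "polygonal_in A n x y \<longleftrightarrow>
     (\<exists>\<alpha> T. polygonal_line geodesic_segments n \<alpha> T \<and> \<alpha> 0 = x \<and> \<alpha> T = y \<and> \<alpha> ` {0..T} \<subseteq> A)"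

lemma geodesic_segments_cong:
  assumes "(f, l) \<in> geodesic_segments" "\<And>s. 0 \<le> s \<Longrightarrow> s \<le> l \<Longrightarrow> f s = g s"
  shows "(g, l) \<in> geodesic_segments"
  using assms by (auto simp: geodesic_segments_def)

lemma polygonal_in_trans:
  assumes "polygonal_in A n x y" "polygonal_in A n' y z"
  shows "polygonal_in A (n + n') x z"
proof -
  obtain \<alpha> T where a: "polygonal_line geodesic_segments n \<alpha> T" "\<alpha> 0 = x" "\<alpha> T = y" "\<alpha> ` {0..T} \<subseteq> A"
    using assms(1) by (auto simp: polygonal_in_def)
  obtain \<beta> S where b: "polygonal_line geodesic_segments n' \<beta> S" "\<beta> 0 = y" "\<beta> S = z" "\<beta> ` {0..S} \<subseteq> A"
    using assms(2) by (auto simp: polygonal_in_def)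
  obtain k t where t: "1 \<le> k" "k \<le> n" "t 0 = 0" "t k = T" "\<And>i. i < k \<Longrightarrow> t i \<le> t (Suc i)"
    "\<And>i. i < k \<Longrightarrow> ((\<lambda>s. \<alpha> (t i + s)), t (Suc i) - t i) \<in> geodesic_segments"
    using a(1) unfolding polygonal_line_def by blast
  obtain j r where r: "1 \<le> j" "j \<le> n'" "r 0 = 0" "r j = S" "\<And>i. i < j \<Longrightarrow> r i \<le> r (Suc i)"
    "\<And>i. i < j \<Longrightarrow> ((\<lambda>s. \<beta> (r i + s)), r (Suc i) - r i) \<in> geodesic_segments"
    using b(1) unfolding polygonal_line_def by blast
  have T: "0 \<le> T" "0 \<le> S" using a(1) b(1) by (auto dest: polygonal_line_lipschitz)
  have tT: "t (Suc i) \<le> T" if "i < k" for i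
    using Suc_leI[OF that] by (induction rule: inc_induct) (auto simp: t(4) intro: order_trans[OF t(5)])
  have r0: "0 \<le> r i" if "i \<le> j" for i
    using that by (induction i) (auto simp: r(3) intro: order_trans[OF _ r(5)])
  define f where "f s = (if s \<le> T then \<alpha> s else \<beta> (s - T))" for s
  define u where "u i = (if i \<le> k then t i else T + r (i - k))" for i
  \<comment> \<open>At the junction both branches agree, since
    \<open>\<alpha> T = y = \<beta> 0\<close>; likewise \<open>t k = T + r 0\<close> for the
    breakpoints.\<close>
  have f\<beta>: "f (T + s) = \<beta> s" if "0 \<le> s" for s
    using that a b by (auto simp: f_def)
  have u\<beta>: "u (k + i) = T + r i" for i
    using t r by (auto simp: u_def)
  have "u i \<le> u (Suc i) \<and> ((\<lambda>s. f (u i + s)), u (Suc i) - u i) \<in> geodesic_segments"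
    if "i < k + j" for i
  proof (cases "i < k")
    case True
    have "((\<lambda>s. f (t i + s)), t (Suc i) - t i) \<in> geodesic_segments"
      by (rule geodesic_segments_cong[OF t(6)[OF True]]) (use tT[OF True] in \<open>auto simp: f_def\<close>)
    then show ?thesis using True t(5) by (simp add: u_def)
  next
    case False
    then obtain i' where i': "i = k + i'" "i' < j" using \<open>i < k + j\<close> le_Suc_ex by force
    have "((\<lambda>s. f (T + r i' + s)), r (Suc i') - r i') \<in> geodesic_segments"
      by (rule geodesic_segments_cong[OF r(6)[OF i'(2)]])
        (use r0[of i'] i' in \<open>auto simp: f\<beta> add.assoc\<close>)
    then show ?thesis using i' u\<beta>[of i'] u\<beta>[of "Suc i'"] r(5)[of i'] by simp
  qed
  then have "polygonal_line geodesic_segments (n + n') f (T + S)"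
    unfolding polygonal_line_def using t(1-3) r(1-4) u\<beta>[of j]
    by (intro exI[of _ "k + j"] exI[of _ u]) (auto simp: u_def)
  moreover have "f 0 = x" "f (T + S) = z" using T a f\<beta>[of S] b by (auto simp: f_def)
  moreover have "f ` {0..T + S} \<subseteq> A"
    using a(4) b(4) by (auto simp: f_def image_subset_iff)
  ultimately show ?thesis unfolding polygonal_in_def by blast
qed

lemma polygonal_in_segment:
  assumes "(g, l) \<in> geodesic_segments" "g ` {0..l} \<subseteq> A"
  shows "polygonal_in A 1 (g 0) (g l)"
proof -
  have "polygonal_line geodesic_segments 1 g l"
    unfolding polygonal_line_def using assms(1)
    by (intro exI[of _ "1::nat"] exI[of _ "\<lambda>i. if i = 0 then 0 else l"])
      (auto simp: geodesic_segments_def)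
  then show ?thesis using assms(2) unfolding polygonal_in_def by blast
qed

text \<open>Points of a geodesic satisfy the betweenness equation, so staying in \<open>A\<close>
  can be checked by triangle inequalities alone.\<close>

lemma polygonal_in_between:
  fixes x y :: "'a::metric_space"
  assumes "geodesic_metric_space TYPE('a)"
    and "\<And>z. dist x z + dist z y = dist x y \<Longrightarrow> z \<in> A"
  shows "polygonal_in A 1 x y"
proof -
  obtain g l where g: "(g, l) \<in> geodesic_segments" "g 0 = x" "g l = y"
    using assms(1) unfolding geodesic_metric_space_def by fast
  have "g s \<in> A" if "s \<in> {0..l}" for s
  proof (rule assms(2))
    have "dist (g 0) (g s) = s" "dist (g s) (g l) = l - s" "dist (g 0) (g l) = l"
      using g(1) that by (auto simp: geodesic_segments_def)
    then show "dist x (g s) + dist (g s) y = dist x y" using g by simp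
  qed
  then have "g ` {0..l} \<subseteq> A" by blast
  from polygonal_in_segment[OF g(1) this] show ?thesis by (simp only: g)
qed

section \<open>Projections of balls\<close>

text \<open>A point \<open>z\<close> between \<open>x\<close> and \<open>p\<close> with
  \<open>dist z m < R\<close> would have \<open>dist z p > R\<close>, so the route from
  \<open>x\<close> through \<open>z\<close> to \<open>m\<close> would be shorter than
  \<open>dist x p\<close>, contradicting that \<open>p\<close> is no farther from \<open>x\<close>
  than \<open>m\<close> is.\<close>

lemma polygonal_in_away:
  fixes p x m :: "'a::metric_space"
  assumes geo: "geodesic_metric_space TYPE('a)"
    and "dist x p \<le> dist x m" and "2 * R \<le> dist p m"
  shows "polygonal_in {z. R \<le> dist z m} 1 x p" "polygonal_in {z. R \<le> dist z m} 1 p x"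
proof -
  have "R \<le> dist z m" if "dist x z + dist z p = dist x p" for z
    using that assms(2,3) dist_triangle[of p m z] dist_triangle[of x m z] by (simp add: dist_commute)
  then show "polygonal_in {z. R \<le> dist z m} 1 x p" "polygonal_in {z. R \<le> dist z m} 1 p x"
    using polygonal_in_between[OF geo, of x p] polygonal_in_between[OF geo, of p x]
    by (simp_all add: dist_commute add.commute)
qed

text \<open>Equality in the triangle inequality makes the segment radial: along it the distance to
  \<open>m\<close> never drops below that of the nearer end.\<close>

lemma polygonal_in_radial:
  fixes a b m :: "'a::metric_space"
  assumes geo: "geodesic_metric_space TYPE('a)"
    and "dist a b = \<bar>dist a m - dist b m\<bar>" and "R \<le> dist a m" "R \<le> dist b m"
  shows "polygonal_in {z. R \<le> dist z m} 1 a b"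
proof (rule polygonal_in_between[OF geo], simp)
  fix z assume "dist a z + dist z b = dist a b"
  then show "R \<le> dist z m"
    using assms dist_triangle[of a m z] dist_triangle[of b m z] by (auto simp: dist_commute)
qed

text \<open>The line runs through \<open>a\<close>, \<open>p1\<close>, \<open>y1\<close>,
  \<open>x\<close>, \<open>y2\<close>, \<open>p2\<close>, \<open>b\<close>, where \<open>x\<close>
  is the centre of the ball and \<open>p1\<close>, \<open>p2\<close> are projections of
  \<open>y1\<close>, \<open>y2\<close>. The ends are moved inwards from \<open>p1\<close>,
  \<open>p2\<close> to \<open>a\<close>, \<open>b\<close> because navigability wants them within
  \<open>2 * R\<close> of \<open>m\<close>.\<close>

lemma polygonal_in_around_midpoint:
  fixes x y1 y2 :: "'a::metric_space"
  assumes geo: "geodesic_metric_space TYPE('a)" and R: "0 \<le> R"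
    and y: "dist x y1 \<le> dist x m" "dist x y2 \<le> dist x m"
    and p: "dist y1 p1 \<le> dist y1 m" "dist y2 p2 \<le> dist y2 m"
    and m: "dist p1 m = 4 * R" "dist p2 m = 4 * R" "dist a m = 2 * R" "dist b m = 2 * R"
    and ab: "dist a p1 = 2 * R" "dist p2 b = 2 * R"
  shows "polygonal_in {z. R \<le> dist z m} 6 a b"
proof -
  let ?A = "{z. R \<le> dist z m}"
  \<comment> \<open>Since \<open>p1\<close> is no farther from \<open>y1\<close> than
    \<open>m\<close> is, \<open>4 * R = dist p1 m\<close> is at most \<open>2 * dist y1 m\<close>;
    likewise for \<open>y2\<close>.\<close>
  have y2R: "2 * R \<le> dist y1 m" "2 * R \<le> dist y2 m"
    using p m dist_triangle[of p1 m y1] dist_triangle[of p2 m y2] by (auto simp: dist_commute)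
  have "polygonal_in ?A 1 a p1" "polygonal_in ?A 1 p2 b"
    by (rule polygonal_in_radial[OF geo]; use R m ab in simp)+
  moreover have "polygonal_in ?A 1 p1 y1" "polygonal_in ?A 1 y2 p2"
    by (rule polygonal_in_away[OF geo]; use R m p in simp)+
  moreover have "polygonal_in ?A 1 y1 x" "polygonal_in ?A 1 x y2"
    by (rule polygonal_in_away[OF geo]; use y y2R in simp)+
  ultimately have "polygonal_in ?A (1 + (1 + (1 + (1 + (1 + 1))))) a b"
    by (blast intro: polygonal_in_trans)
  moreover have "1 + (1 + (1 + (1 + (1 + 1)))) = (6::nat)" by simp
  ultimately show ?thesis by (simp only:)
qed

text \<open>Navigability in the form used below: the detour matters only as a Lipschitz path of
  bounded duration, so its number of segments is forgotten.\<close>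

lemma navigable_detour:
  assumes "navigable (geodesic_segments :: ((real \<Rightarrow> 'a::metric_space) \<times> real) set)"
  obtains C where "1 \<le> C"
    "\<forall>R (m::'a) n a b. C \<le> R \<longrightarrow> polygonal_in {z. R \<le> dist z m} n a b \<longrightarrow>
       dist a m \<le> 2 * R \<longrightarrow> dist b m \<le> 2 * R \<longrightarrow>
       (\<exists>p T. 1-lipschitz_on {0..T} p \<and> 0 \<le> T \<and> T \<le> C * real n * R \<and> p 0 = a \<and> p T = b \<and>
         (\<forall>s\<in>{0..T}. R / C < dist (p s) m))"
proof -
  obtain C k where C: "1 \<le> C" and nav: "\<forall>R (m::'a) n \<alpha> T.
       C \<le> R \<and> polygonal_line geodesic_segments n \<alpha> T \<and> R \<le> infdist m (\<alpha> ` {0..T}) \<and>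
       dist (\<alpha> 0) m \<le> 2 * R \<and> dist (\<alpha> T) m \<le> 2 * R \<longrightarrow>
       (\<exists>p T'. polygonal_line geodesic_segments (k * n) p T' \<and> p 0 = \<alpha> 0 \<and> p T' = \<alpha> T \<and>
          curve_length p 0 T' \<le> ereal (C * real n * R) \<and>
          p ` {0..T'} \<inter> cball m (R / C) = {})"
    using assms unfolding navigable_def by blast
  have "\<exists>p T. 1-lipschitz_on {0..T} p \<and> 0 \<le> T \<and> T \<le> C * real n * R \<and> p 0 = a \<and> p T = b \<and>
         (\<forall>s\<in>{0..T}. R / C < dist (p s) m)"
    if R: "C \<le> R" and pl: "polygonal_in {z. R \<le> dist z m} n a b"
      and ends: "dist a m \<le> 2 * R" "dist b m \<le> 2 * R" for R n a b and m :: 'a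
  proof -
    obtain \<alpha> T where \<alpha>: "polygonal_line geodesic_segments n \<alpha> T" "\<alpha> 0 = a" "\<alpha> T = b"
      "\<alpha> ` {0..T} \<subseteq> {z. R \<le> dist z m}"
      using pl by (auto simp: polygonal_in_def)
    \<comment> \<open>The image is nonempty by \<open>0 \<le> T\<close>, so \<open>infdist\<close>
      is a true infimum and not its default 0.\<close>
    have "R \<le> infdist m (\<alpha> ` {0..T})"
      using \<alpha>(4) polygonal_line_lipschitz(1)[OF \<alpha>(1)]
      by (subst infdist_notempty) (auto intro!: cINF_greatest simp: dist_commute)
    then obtain p T' where p: "polygonal_line geodesic_segments (k * n) p T'" "p 0 = a" "p T' = b"
      "curve_length p 0 T' \<le> ereal (C * real n * R)" "p ` {0..T'} \<inter> cball m (R / C) = {}"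
      using nav[rule_format, of R n \<alpha> T m] \<alpha> R ends by auto
    have "T' \<le> C * real n * R"
      using order_trans[OF polygonal_line_lipschitz(3)[OF p(1)] p(4)] by simp
    moreover have "\<forall>s\<in>{0..T'}. R / C < dist (p s) m"
      using p(5) by (fastforce simp: disjoint_iff dist_commute)
    ultimately show ?thesis using polygonal_line_lipschitz[OF p(1)] p by blast
  qed
  then show thesis using that C by blast
qed

section \<open>Contraction of Morse geodesics\<close>

theorem theorem1p11:
  assumes "geodesic_metric_space TYPE('a::metric_space)"
    and "navigable (geodesic_segments :: ((real \<Rightarrow> 'a) \<times> real) set)"
  shows "morse_dichotomous TYPE('a)"
proof -
  note geo = assms(1)
  obtain C where C: "1 \<le> C" and nav:
    "\<forall>R (m::'a) n a b. C \<le> R \<longrightarrow> polygonal_in {z. R \<le> dist z m} n a b \<longrightarrow>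
       dist a m \<le> 2 * R \<longrightarrow> dist b m \<le> 2 * R \<longrightarrow>
       (\<exists>p T. 1-lipschitz_on {0..T} p \<and> 0 \<le> T \<and> T \<le> C * real n * R \<and> p 0 = a \<and> p T = b \<and>
         (\<forall>s\<in>{0..T}. R / C < dist (p s) m))"
    by (rule navigable_detour[OF assms(2)])
  \<comment> \<open>Six segments give a detour of duration at most \<open>C * 6 * R\<close>, which
    is \<open>L * \<rho>\<close> for \<open>\<rho> = R / C\<close> and
    \<open>L = 6 * C\<^sup>2\<close>.\<close>
  define Q where "Q = 1 + 8 * (6 * C\<^sup>2 + 1)"
  have "strongly_contracting (8 * (C * (1 + 6 * (M Q 1 + 1)))) I \<gamma>"
    if M: "morse_gauge M" and g: "geodesic I \<gamma>" and morse: "morse M I \<gamma>" for M I and \<gamma> :: "real \<Rightarrow> 'a"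
  proof -
    \<comment> \<open>For \<open>R > ?R\<close>, half of \<open>R / C\<close> exceeds
      \<open>3 * (M Q 1 + 1)\<close>, the bound of \<open>morse_quasi_geodesic_near\<close> with
      \<open>e = 1\<close>; the summand 1 secures \<open>1 \<le> R / C\<close>.\<close>
    let ?R = "C * (1 + 6 * (M Q 1 + 1))"
    have "1 \<le> Q" using C by (simp add: Q_def)
    then have M0: "0 \<le> M Q 1" using M by (simp add: morse_gauge_def)
    have R0: "C \<le> ?R" using mult_left_mono[of 1 "1 + 6 * (M Q 1 + 1)" C] M0 C by simp
    have gd: "dist (\<gamma> s) (\<gamma> t) = \<bar>s - t\<bar>" if "s \<in> I" "t \<in> I" for s t
      using g that by (simp add: geodesic_def)
    \<comment> \<open>One-sided on purpose: exchanging the two points later bounds the absolute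
      value.\<close>
    have ordered: "t - s \<le> 8 * ?R"
      if B: "B \<in> {ball x r, cball x r}" "B \<inter> \<gamma> ` I = {}"
        and y: "y1 \<in> B" "y2 \<in> B" and st: "s \<in> I" "t \<in> I"
        and cl: "\<gamma> s \<in> closest_points (\<gamma> ` I) y1" "\<gamma> t \<in> closest_points (\<gamma> ` I) y2"
      for x r B y1 y2 s t
    proof (rule ccontr)
      assume "\<not> t - s \<le> 8 * ?R"
      \<comment> \<open>An eighth puts both projection points at distance \<open>4 * R\<close> from
        the midpoint \<open>\<gamma> u\<close>.\<close>
      define R where "R = (t - s) / 8"
      define u where "u = (s + t) / 2"
      have "?R < R" using \<open>\<not> t - s \<le> 8 * ?R\<close> by (simp add: R_def)
      then have R: "?R < R" "0 < R" using R0 C by linarith+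
      have su: "s = u - 4 * R" "t = u + 4 * R" by (auto simp: R_def u_def field_simps)
      have "v \<in> I" if "s \<le> v" "v \<le> t" for v
        using g st that unfolding geodesic_def is_interval_1 by blast
      then have I: "u \<in> I" "u - 2 * R \<in> I" "u + 2 * R \<in> I" using R su by auto
      \<comment> \<open>Disjointness enters here: the centre \<open>x\<close> is no closer to
        \<open>\<gamma> u\<close> than to any point of the ball, open or closed.\<close>
      have "\<gamma> u \<notin> B" using B I by auto
      then have "dist x y1 \<le> dist x (\<gamma> u)" "dist x y2 \<le> dist x (\<gamma> u)"
        using B(1) y by auto
      moreover have "dist y1 (\<gamma> s) \<le> dist y1 (\<gamma> u)" "dist y2 (\<gamma> t) \<le> dist y2 (\<gamma> u)"
        using cl I by (auto simp: closest_points_def)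
      ultimately have hex: "polygonal_in {z. R \<le> dist z (\<gamma> u)} 6 (\<gamma> (u - 2 * R)) (\<gamma> (u + 2 * R))"
        by (rule polygonal_in_around_midpoint[OF geo less_imp_le[OF R(2)]])
          (use R(2) st I in \<open>auto simp: gd su\<close>)
      have "C \<le> R" using R R0 by linarith
      moreover have "dist (\<gamma> (u - 2 * R)) (\<gamma> u) \<le> 2 * R" "dist (\<gamma> (u + 2 * R)) (\<gamma> u) \<le> 2 * R"
        using R I by (auto simp: gd)
      ultimately have "\<exists>p T. 1-lipschitz_on {0..T} p \<and> 0 \<le> T \<and> T \<le> C * real 6 * R \<and>
          p 0 = \<gamma> (u - 2 * R) \<and> p T = \<gamma> (u + 2 * R) \<and> (\<forall>v\<in>{0..T}. R / C < dist (p v) (\<gamma> u))"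
        using nav hex by blast
      then obtain p T where
        p: "1-lipschitz_on {0..T} p" "0 \<le> T" "T \<le> C * 6 * R" "p 0 = \<gamma> (u - 2 * R)"
          "p T = \<gamma> (u + 2 * R)" "\<And>v. v \<in> {0..T} \<Longrightarrow> R / C < dist (p v) (\<gamma> u)"
        by auto
      have RC: "1 + 6 * (M Q 1 + 1) < R / C"
        using R C by (subst pos_less_divide_eq) (auto simp: mult.commute)
      have TC: "T \<le> 6 * C\<^sup>2 * (R / C)" using p(3) C by (simp add: power2_eq_square)
      have "1 \<le> R / C" "0 \<le> 6 * C\<^sup>2" using RC M0 by auto
      then obtain \<eta> S where \<eta>: "0 \<le> S" "\<eta> 0 = p 0" "\<eta> S = p T"
        "quasi_geodesic Q 1 {0..S} \<eta>" "\<forall>v\<in>{0..S}. R / C / 2 < dist (\<eta> v) (\<gamma> u)"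
        using quasi_geodesic_avoiding_ball[OF geo p(1,2) TC _ _ p(6), folded Q_def] by metis
      \<comment> \<open>The Morse property is applied to the piece of \<open>\<gamma>\<close> from
        \<open>u - 2 * R\<close> to \<open>u + 2 * R\<close>, whose ends the detour joins.\<close>
      obtain v where "v \<in> {0..S}" "dist (\<eta> v) (\<gamma> u) \<le> 3 * (M Q 1 + 1)"
        by (rule morse_quasi_geodesic_near[OF g morse I(2,3) _ _ \<eta>(1,4), of u 1])
          (use R \<eta> p in auto)
      then show False using \<eta>(5) RC by force
    qed
    show ?thesis
      unfolding strongly_contracting_def Let_def
    proof (intro allI ballI impI)
      fix x r B
      assume B: "B \<in> {ball x r, cball x r}" "B \<inter> \<gamma> ` I = {}"
      let ?P = "\<Union>z\<in>B. closest_points (\<gamma> ` I) z"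
      have P: "dist p q \<le> 8 * ?R" if pq: "p \<in> ?P" "q \<in> ?P" for p q
      proof -
        obtain y1 y2 where y: "y1 \<in> B" "p \<in> closest_points (\<gamma> ` I) y1"
          "y2 \<in> B" "q \<in> closest_points (\<gamma> ` I) y2"
          using pq by blast
        moreover obtain s t where st: "s \<in> I" "p = \<gamma> s" "t \<in> I" "q = \<gamma> t"
          using y(2,4) unfolding closest_points_def by blast
        ultimately show ?thesis
          using ordered[OF B, of y1 y2 s t] ordered[OF B, of y2 y1 t s] gd by (auto simp: abs_le_iff)
      qed
      then have "bounded ?P"
        unfolding bounded_two_points by blast
      \<comment> \<open>\<open>R0\<close> and \<open>C\<close> cover an empty \<open>?P\<close>,
        whose diameter is 0 by convention.\<close>
      moreover have "diameter ?P \<le> 8 * ?R"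
        using P R0 C unfolding diameter_def by (auto intro!: cSUP_least)
      ultimately show "bounded ?P \<and> diameter ?P \<le> 8 * ?R" ..
    qed
  qed
  then show ?thesis unfolding morse_dichotomous_def by blast
qed

end
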